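(* Let $\{X_n\}_{n\ge 0}$ be a finite irreducible discrete time Markov chain with state space $\mathcal S=\{1,\dots,m\}$ and stationary distribution $\{\pi_j\}$, and let $i\in\mathcal S$. Let $f_{i,n}=P\{T_i^{(0)}=n\mid X_0=i\}$ and $g_{i,n}=P\{T_i^{(1)}=n\mid X_0=i\}$ be the distributions of the random hitting time $T_i^{(0)}$ and the random first passage time $T_i^{(1)}$ of the mixing state, starting in state $i$. Then $$f_{i,n}=\begin{cases}\sum_{j\neq i} f_{ij}^{(n)}\pi_j, & n\ge 1,\\ \pi_i, & n=0,\end{cases}\qquad\text{and}\qquad g_{i,n}=\begin{cases}\sum_{j} f_{ij}^{(n)}\pi_j, & n\ge 1,\\ 0, & n=0.\end{cases}$$
   Context: The mixing variable $M$ is a random variable, independent of the chain, with $P[M=j]=\pi_j$ for all $j\in\mathcal S$; its value is called the mixing state. Given $X_0=i$, $T_i^{(0)}=\min\{n\ge 0: X_n=M\}$ and $T_i^{(1)}=\min\{n\ge 1: X_n=M\}$. The $n$-step first passage probabilities are, for $n\ge1$, $f_{ij}^{(n)}=P\{X_n=j,\ X_k\ne j \text{ for } k=1,\dots,n-1\mid X_0=i\}$. *)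

theory Defs
  imports "HOL-Probability.Probability" "HOL-Library.Extended_Nat"
begin

locale finite_markov_chain = prob_space \<Omega> for \<Omega> :: "'w measure" +
  fixes S :: "'s set" and p :: "'s \<Rightarrow> 's \<Rightarrow> real" and X :: "nat \<Rightarrow> 'w \<Rightarrow> 's"
  assumes finite_states: "finite S"
    and rv_X: "\<And>n. X n \<in> measurable \<Omega> (count_space S)"
    and p_nonneg: "\<And>i j. i \<in> S \<Longrightarrow> j \<in> S \<Longrightarrow> p i j \<ge> 0"
    and p_sum: "\<And>i. i \<in> S \<Longrightarrow> (\<Sum>j\<in>S. p i j) = 1"
    and markov: "\<And>n x j. (\<forall>k\<le>n. x k \<in> S) \<Longrightarrow> j \<in> S \<Longrightarrow>
        \<P>(\<omega> in \<Omega>. \<forall>k\<le>n. X k \<omega> = x k) > 0 \<Longrightarrow>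
        \<P>(\<omega> in \<Omega>. X (Suc n) \<omega> = j \<bar> \<forall>k\<le>n. X k \<omega> = x k) = p (x n) j"

primrec n_step :: "'s set \<Rightarrow> ('s \<Rightarrow> 's \<Rightarrow> real) \<Rightarrow> nat \<Rightarrow> 's \<Rightarrow> 's \<Rightarrow> real" where
  "n_step S p 0 i j = (if i = j then 1 else 0)"
| "n_step S p (Suc n) i j = (\<Sum>k\<in>S. n_step S p n i k * p k j)"

definition irreducible_chain :: "'s set \<Rightarrow> ('s \<Rightarrow> 's \<Rightarrow> real) \<Rightarrow> bool" where
  "irreducible_chain S p \<longleftrightarrow> (\<forall>i\<in>S. \<forall>j\<in>S. \<exists>n. n_step S p n i j > 0)"

definition stationary_distribution :: "'s set \<Rightarrow> ('s \<Rightarrow> 's \<Rightarrow> real) \<Rightarrow> ('s \<Rightarrow> real) \<Rightarrow> bool" where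
  "stationary_distribution S p \<pi> \<longleftrightarrow>
     (\<forall>j\<in>S. \<pi> j \<ge> 0) \<and> (\<Sum>j\<in>S. \<pi> j) = 1 \<and> (\<forall>j\<in>S. (\<Sum>i\<in>S. \<pi> i * p i j) = \<pi> j)"

text \<open>Independence of the mixing variable from the chain is independence from the whole process,
  i.e. of the sigma-algebra generated by \<open>M\<close> and the one generated by \<open>(X\<^sub>n)\<^sub>n\<close>. (The library's
  \<open>indep_var\<close> is not applicable, as it requires both variables to have the same type.)\<close>

definition mixing_variable ::
    "'w measure \<Rightarrow> 's set \<Rightarrow> ('s \<Rightarrow> real) \<Rightarrow> (nat \<Rightarrow> 'w \<Rightarrow> 's) \<Rightarrow> ('w \<Rightarrow> 's) \<Rightarrow> bool" where
  "mixing_variable \<Omega> S \<pi> X M \<longleftrightarrow>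
     M \<in> measurable \<Omega> (count_space S) \<and>
     (\<forall>j\<in>S. \<P>(\<omega> in \<Omega>. M \<omega> = j) = \<pi> j) \<and>
     prob_space.indep_set \<Omega>
       (sets (vimage_algebra (space \<Omega>) M (count_space S)))
       (sets (vimage_algebra (space \<Omega>) (\<lambda>\<omega> n. X n \<omega>) (Pi\<^sub>M UNIV (\<lambda>_. count_space S))))"

text \<open>The times below take the value \<open>\<infinity>\<close> (the infimum of the empty set) on the event that the
  mixing state is never reached.\<close>

definition hitting_time :: "(nat \<Rightarrow> 'w \<Rightarrow> 's) \<Rightarrow> ('w \<Rightarrow> 's) \<Rightarrow> 'w \<Rightarrow> enat" where
  "hitting_time X M \<omega> = Inf {enat n | n. n \<ge> 0 \<and> X n \<omega> = M \<omega>}"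

definition first_passage_time :: "(nat \<Rightarrow> 'w \<Rightarrow> 's) \<Rightarrow> ('w \<Rightarrow> 's) \<Rightarrow> 'w \<Rightarrow> enat" where
  "first_passage_time X M \<omega> = Inf {enat n | n. n \<ge> 1 \<and> X n \<omega> = M \<omega>}"

definition hitting_dist ::
    "'w measure \<Rightarrow> (nat \<Rightarrow> 'w \<Rightarrow> 's) \<Rightarrow> ('w \<Rightarrow> 's) \<Rightarrow> 's \<Rightarrow> nat \<Rightarrow> real" where
  "hitting_dist \<Omega> X M i n = \<P>(\<omega> in \<Omega>. hitting_time X M \<omega> = enat n \<bar> X 0 \<omega> = i)"

definition first_passage_dist ::
    "'w measure \<Rightarrow> (nat \<Rightarrow> 'w \<Rightarrow> 's) \<Rightarrow> ('w \<Rightarrow> 's) \<Rightarrow> 's \<Rightarrow> nat \<Rightarrow> real" where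
  "first_passage_dist \<Omega> X M i n =
     \<P>(\<omega> in \<Omega>. first_passage_time X M \<omega> = enat n \<bar> X 0 \<omega> = i)"

text \<open>Only meaningful for \<open>n \<ge> 1\<close>.\<close>

definition first_passage_prob ::
    "'w measure \<Rightarrow> (nat \<Rightarrow> 'w \<Rightarrow> 's) \<Rightarrow> 's \<Rightarrow> 's \<Rightarrow> nat \<Rightarrow> real" where
  "first_passage_prob \<Omega> X i j n =
     \<P>(\<omega> in \<Omega>. X n \<omega> = j \<and> (\<forall>k\<in>{1..<n}. X k \<omega> \<noteq> j) \<bar> X 0 \<omega> = i)"

end

theory Submission
  imports Defs
begin

text \<open>Partition the event by the value of the mixing state: on \<open>M = j\<close> the mixing time is the
  hitting (or first passage) time of the fixed state \<open>j\<close>, and independence of \<open>M\<close> from the chain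
  splits off the factor \<open>\<pi> j\<close>. For the hitting time, \<open>j = i\<close> contributes only at time 0.\<close>

text \<open>The infimum of the empty set is \<infinity>, so a finite infimum forces nonemptiness and
  is then attained by well-ordering. This turns "the time equals \<open>n\<close>" into a condition
  on finitely many coordinates of the path.\<close>

lemma Inf_enat_Collect_eq_iff:
  "Inf {enat k | k. P k} = enat n \<longleftrightarrow> P n \<and> (\<forall>k<n. \<not> P k)"
proof
  assume eq: "Inf {enat k | k. P k} = enat n"
  then have "{enat k | k. P k} \<noteq> {}"
    by (auto simp: Inf_enat_def split: if_splits)
  then have "Inf {enat k | k. P k} \<in> {enat k | k. P k}"
    unfolding Inf_enat_def by (auto intro: LeastI)
  moreover have "\<not> P k" if "k < n" for k
    using Inf_lower[of "enat k" "{enat k | k. P k}"] eq that by auto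
  ultimately show "P n \<and> (\<forall>k<n. \<not> P k)"
    using eq by auto
next
  assume "P n \<and> (\<forall>k<n. \<not> P k)"
  then show "Inf {enat k | k. P k} = enat n"
    by (intro antisym Inf_lower Inf_greatest) (auto simp: not_less[symmetric])
qed

lemma hitting_time_eq_iff:
  "hitting_time X M \<omega> = enat n \<longleftrightarrow> X n \<omega> = M \<omega> \<and> (\<forall>k<n. X k \<omega> \<noteq> M \<omega>)"
  unfolding hitting_time_def Inf_enat_Collect_eq_iff by simp

lemma first_passage_time_eq_iff:
  "first_passage_time X M \<omega> = enat n \<longleftrightarrow>
     1 \<le> n \<and> X n \<omega> = M \<omega> \<and> (\<forall>k\<in>{1..<n}. X k \<omega> \<noteq> M \<omega>)"
  unfolding first_passage_time_def Inf_enat_Collect_eq_iff by auto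

text \<open>A property of the path that depends on the mixing state is encoded as a family
  \<open>E\<close>, one path property for each state. This lets \<open>M\<close> be frozen at each
  value \<open>j\<close> before independence is applied.\<close>

lemma prob_mixing_variable:
  assumes "prob_space \<Omega>" and "finite S"
    and X: "\<And>n. X n \<in> measurable \<Omega> (count_space S)"
    and mix: "mixing_variable \<Omega> S \<pi> X M"
    and E: "\<And>j. j \<in> S \<Longrightarrow> Measurable.pred (Pi\<^sub>M UNIV (\<lambda>_. count_space S)) (E j)"
  shows "\<P>(\<omega> in \<Omega>. E (M \<omega>) (\<lambda>n. X n \<omega>)) = (\<Sum>j\<in>S. \<P>(\<omega> in \<Omega>. E j (\<lambda>n. X n \<omega>)) * \<pi> j)"
proof -
  interpret prob_space \<Omega> by fact
  let ?N = "Pi\<^sub>M UNIV (\<lambda>_::nat. count_space S)"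
  let ?path = "\<lambda>\<omega> n. X n \<omega>"
  have M: "M \<in> measurable \<Omega> (count_space S)"
    and \<pi>: "\<And>j. j \<in> S \<Longrightarrow> \<P>(\<omega> in \<Omega>. M \<omega> = j) = \<pi> j"
    and indep: "indep_set (sets (vimage_algebra (space \<Omega>) M (count_space S)))
       (sets (vimage_algebra (space \<Omega>) ?path ?N))"
    using mix by (auto simp: mixing_variable_def)
  have path: "?path \<in> measurable \<Omega> ?N"
    using measurable_space[OF X] by (intro measurable_PiM_single' X) auto
  let ?A = "\<lambda>j. {\<omega> \<in> space \<Omega>. M \<omega> = j}"
  let ?B = "\<lambda>j. {\<omega> \<in> space \<Omega>. E j (?path \<omega>)}"
  have A: "?A j \<in> sets (vimage_algebra (space \<Omega>) M (count_space S))" if "j \<in> S" for j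
  proof -
    have "?A j = M -` {j} \<inter> space \<Omega>" by auto
    then show ?thesis using that by (auto intro: in_vimage_algebra)
  qed
  have B: "?B j \<in> sets (vimage_algebra (space \<Omega>) ?path ?N)" if "j \<in> S" for j
  proof -
    \<comment> \<open>Measurability of \<open>E j\<close> speaks only about points of
      \<open>space ?N\<close>; every path lies there, so the preimage is all of
      \<open>?B j\<close>.\<close>
    have "?B j = ?path -` {x \<in> space ?N. E j x} \<inter> space \<Omega>"
      using measurable_space[OF path] by auto
    then show ?thesis
      using E[OF that] by (simp only: pred_def in_vimage_algebra)
  qed
  \<comment> \<open>Independence of two families includes that both consist of events.\<close>
  have indep_sets: "?A j \<in> events" "?B j \<in> events" if "j \<in> S" for j
    using indep_setD_ev1[OF indep] indep_setD_ev2[OF indep] A[OF that] B[OF that] by auto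
  have "{\<omega> \<in> space \<Omega>. E (M \<omega>) (?path \<omega>)} = (\<Union>j\<in>S. ?A j \<inter> ?B j)"
    using measurable_space[OF M] by auto
  also have "prob \<dots> = (\<Sum>j\<in>S. prob (?A j \<inter> ?B j))"
    using \<open>finite S\<close> indep_sets
    by (intro finite_measure_finite_Union) (auto simp: disjoint_family_on_def)
  also have "\<dots> = (\<Sum>j\<in>S. prob (?B j) * \<pi> j)"
    using indep_setD[OF indep A B] \<pi> by (intro sum.cong) (auto simp: mult.commute)
  finally show ?thesis .
qed

text \<open>Since \<open>F\<close> concerns the path alone, it can be absorbed into each
  \<open>E j\<close>; dividing by the probability of \<open>F\<close> then gives the claim. If that
  probability is 0, both sides are 0 by the convention for division.\<close>

lemma cond_prob_mixing_variable:
  assumes "prob_space \<Omega>" and "finite S"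
    and "\<And>n. X n \<in> measurable \<Omega> (count_space S)"
    and "mixing_variable \<Omega> S \<pi> X M"
    and "\<And>j. j \<in> S \<Longrightarrow> Measurable.pred (Pi\<^sub>M UNIV (\<lambda>_. count_space S)) (E j)"
    and "Measurable.pred (Pi\<^sub>M UNIV (\<lambda>_. count_space S)) F"
  shows "\<P>(\<omega> in \<Omega>. E (M \<omega>) (\<lambda>n. X n \<omega>) \<bar> F (\<lambda>n. X n \<omega>)) =
    (\<Sum>j\<in>S. \<P>(\<omega> in \<Omega>. E j (\<lambda>n. X n \<omega>) \<bar> F (\<lambda>n. X n \<omega>)) * \<pi> j)"
  using prob_mixing_variable[OF assms(1-4), of "\<lambda>j x. E j x \<and> F x"] assms(5,6)
  by (simp add: cond_prob_def sum_divide_distrib)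

lemma pred_PiM_count_space_eq:
  "Measurable.pred (Pi\<^sub>M UNIV (\<lambda>_. count_space S)) (\<lambda>x. x n = j)"
  by (rule measurable_compose[OF measurable_component_singleton]) auto

theorem theorem2p1:
  fixes \<Omega> :: "'w measure" and m i :: nat and p :: "nat \<Rightarrow> nat \<Rightarrow> real"
    and X :: "nat \<Rightarrow> 'w \<Rightarrow> nat" and M :: "'w \<Rightarrow> nat" and \<pi> :: "nat \<Rightarrow> real"
  assumes "finite_markov_chain \<Omega> {1..m} p X"
    and "irreducible_chain {1..m} p"
    and "stationary_distribution {1..m} p \<pi>"
    and "mixing_variable \<Omega> {1..m} \<pi> X M"
    and "i \<in> {1..m}"
    and "\<P>(\<omega> in \<Omega>. X 0 \<omega> = i) > 0"
  shows "(\<forall>n. hitting_dist \<Omega> X M i n =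
            (if n \<ge> 1 then \<Sum>j\<in>{1..m} - {i}. first_passage_prob \<Omega> X i j n * \<pi> j else \<pi> i)) \<and>
         (\<forall>n. first_passage_dist \<Omega> X M i n =
            (if n \<ge> 1 then \<Sum>j\<in>{1..m}. first_passage_prob \<Omega> X i j n * \<pi> j else 0))"
proof (intro conjI allI)
  fix n
  interpret finite_markov_chain \<Omega> "{1..m}" p X by fact
  \<comment> \<open>The conditioning event is fixed here as the start \<open>X 0 = i\<close>;
    \<open>E\<close> stays open, to serve both times.\<close>
  note cond = cond_prob_mixing_variable[OF prob_space_axioms finite_states rv_X assms(4)
      _ pred_PiM_count_space_eq[where n = 0 and j = i]]
  note [measurable] = pred_PiM_count_space_eq
  have "hitting_dist \<Omega> X M i n =
      (\<Sum>j\<in>{1..m}. \<P>(\<omega> in \<Omega>. X n \<omega> = j \<and> (\<forall>k<n. X k \<omega> \<noteq> j) \<bar> X 0 \<omega> = i) * \<pi> j)"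
    unfolding hitting_dist_def hitting_time_eq_iff
    by (rule cond[where E = "\<lambda>j x. x n = j \<and> (\<forall>k<n. x k \<noteq> j)"]) measurable
  also have "\<dots> = (\<Sum>j\<in>{1..m}. if j = i then if n \<ge> 1 then 0 else \<pi> i
      else if n \<ge> 1 then first_passage_prob \<Omega> X i j n * \<pi> j else 0)"
  proof (intro sum.cong refl)
    fix j
    \<comment> \<open>Hitting also excludes time 0, unlike first passage. Given a start in
      \<open>i\<close>, this extra condition is impossible for \<open>j = i\<close> and automatic
      otherwise.\<close>
    have *: "(\<forall>k<n. x k \<noteq> j) \<longleftrightarrow> x 0 \<noteq> j \<and> (\<forall>k\<in>{1..<n}. x k \<noteq> j)" if "n \<ge> 1" for x :: "nat \<Rightarrow> nat"
      using that by (auto simp: Suc_le_eq)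
    show "\<P>(\<omega> in \<Omega>. X n \<omega> = j \<and> (\<forall>k<n. X k \<omega> \<noteq> j) \<bar> X 0 \<omega> = i) * \<pi> j =
      (if j = i then if n \<ge> 1 then 0 else \<pi> i
       else if n \<ge> 1 then first_passage_prob \<Omega> X i j n * \<pi> j else 0)"
    proof (cases "n \<ge> 1")
      case True
      have "{\<omega> \<in> space \<Omega>. (X n \<omega> = j \<and> (\<forall>k<n. X k \<omega> \<noteq> j)) \<and> X 0 \<omega> = i} =
        (if j = i then {} else
          {\<omega> \<in> space \<Omega>. (X n \<omega> = j \<and> (\<forall>k\<in>{1..<n}. X k \<omega> \<noteq> j)) \<and> X 0 \<omega> = i})"
        by (subst *[OF True]) auto
      then show ?thesis
        using True by (simp add: cond_prob_def first_passage_prob_def)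
    next
      case False
      then have "n = 0" by simp
      have "{\<omega> \<in> space \<Omega>. X 0 \<omega> = j \<and> X 0 \<omega> = i} =
        (if j = i then {\<omega> \<in> space \<Omega>. X 0 \<omega> = i} else {})"
        by auto
      \<comment> \<open>Positivity of the probability of \<open>X 0 = i\<close> makes the
        conditional probability for \<open>j = i\<close> equal to 1 instead of 0/0 = 0.\<close>
      then show ?thesis
        using \<open>n = 0\<close> assms(6) by (simp add: cond_prob_def)
    qed
  qed
  also have "\<dots> = (if n \<ge> 1 then \<Sum>j\<in>{1..m} - {i}. first_passage_prob \<Omega> X i j n * \<pi> j else \<pi> i)"
    by (subst sum.remove[OF finite_states assms(5)]) (auto intro!: sum.cong sum.neutral)
  finally show "hitting_dist \<Omega> X M i n =
      (if n \<ge> 1 then \<Sum>j\<in>{1..m} - {i}. first_passage_prob \<Omega> X i j n * \<pi> j else \<pi> i)" .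
  have "first_passage_dist \<Omega> X M i n = (\<Sum>j\<in>{1..m}.
      \<P>(\<omega> in \<Omega>. 1 \<le> n \<and> X n \<omega> = j \<and> (\<forall>k\<in>{1..<n}. X k \<omega> \<noteq> j) \<bar> X 0 \<omega> = i) * \<pi> j)"
    unfolding first_passage_dist_def first_passage_time_eq_iff
    by (rule cond[where E = "\<lambda>j x. 1 \<le> n \<and> x n = j \<and> (\<forall>k\<in>{1..<n}. x k \<noteq> j)"]) measurable
  \<comment> \<open>The conjunct \<open>1 \<le> n\<close> empties the event at \<open>n = 0\<close>.
    For later \<open>n\<close> the term \<open>j = i\<close> survives, because a return to the start
    counts as a passage.\<close>
  then show "first_passage_dist \<Omega> X M i n =
      (if n \<ge> 1 then \<Sum>j\<in>{1..m}. first_passage_prob \<Omega> X i j n * \<pi> j else 0)"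
    by (simp add: first_passage_prob_def cond_prob_def)
qed

end
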